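(* Let $n\ge 3$. Every saturated convex $\Theta^3$-drawing of a graph $G$ on $n$ vertices contains at least $\frac72 n-8$ edges.
   Context: Graphs are finite and simple. In a straight-line drawing, vertices are distinct points of the plane in general position (no three on a line) and edges are straight-line segments; two edges cross if their relative interiors share a point. A $\Theta^3$-drawing of a graph $G$ is a straight-line drawing $\Gamma$ of $G$ for which there exists an edge-coloring $\varphi\colon E(G)\to\{1,2,3\}$ such that no two edges of the same color cross. The drawing is convex if its vertices are in convex position. A (non-precolored) $\Theta^3$-drawing $\Gamma$ of $G$ is saturated if there are no two distinct vertices $u,v$ with $uv\notin E(G)$ such that $\Gamma$ together with the straight-line edge $uv$ is also a $\Theta^3$-drawing (for some coloring; no coloring is fixed in advance). *)

theory Defs
  imports "HOL-Analysis.Analysis"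
begin

text \<open>A graph is a finite vertex set together with a set of two-element sets of vertices.
  A drawing is a placement \<open>p\<close> of the vertices in the plane; the edges are
  then determined as straight-line segments.\<close>

definition simple_graph :: "'a set \<Rightarrow> 'a set set \<Rightarrow> bool" where
  "simple_graph V E \<longleftrightarrow> finite V \<and> (\<forall>e\<in>E. e \<subseteq> V \<and> card e = 2)"

definition straight_line_drawing :: "'a set \<Rightarrow> 'a set set \<Rightarrow> ('a \<Rightarrow> real^2) \<Rightarrow> bool" where
  "straight_line_drawing V E p \<longleftrightarrow>
     simple_graph V E \<and> inj_on p V \<and>
     (\<forall>u\<in>V. \<forall>v\<in>V. \<forall>w\<in>V. u \<noteq> v \<and> v \<noteq> w \<and> u \<noteq> w \<longrightarrow> \<not> collinear {p u, p v, p w})"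

definition edge_segment :: "('a \<Rightarrow> real^2) \<Rightarrow> 'a set \<Rightarrow> (real^2) set" where
  "edge_segment p e = convex hull (p ` e)"

definition edges_cross :: "('a \<Rightarrow> real^2) \<Rightarrow> 'a set \<Rightarrow> 'a set \<Rightarrow> bool" where
  "edges_cross p e f \<longleftrightarrow>
     e \<noteq> f \<and> rel_interior (edge_segment p e) \<inter> rel_interior (edge_segment p f) \<noteq> {}"

definition theta_drawing :: "nat \<Rightarrow> 'a set \<Rightarrow> 'a set set \<Rightarrow> ('a \<Rightarrow> real^2) \<Rightarrow> bool" where
  "theta_drawing k V E p \<longleftrightarrow>
     straight_line_drawing V E p \<and>
     (\<exists>\<phi> :: 'a set \<Rightarrow> nat. \<phi> ` E \<subseteq> {1..k} \<and>
        (\<forall>e\<in>E. \<forall>f\<in>E. \<phi> e = \<phi> f \<longrightarrow> \<not> edges_cross p e f))"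

definition convex_drawing :: "'a set \<Rightarrow> ('a \<Rightarrow> real^2) \<Rightarrow> bool" where
  "convex_drawing V p \<longleftrightarrow> (\<forall>v\<in>V. p v extreme_point_of (convex hull (p ` V)))"

text \<open>The colouring is existentially quantified inside \<^const>\<open>theta_drawing\<close>, so
  all edges may be recoloured when a new edge is inserted.\<close>

definition saturated_theta_drawing :: "nat \<Rightarrow> 'a set \<Rightarrow> 'a set set \<Rightarrow> ('a \<Rightarrow> real^2) \<Rightarrow> bool" where
  "saturated_theta_drawing k V E p \<longleftrightarrow>
     theta_drawing k V E p \<and>
     \<not> (\<exists>u\<in>V. \<exists>v\<in>V. u \<noteq> v \<and> {u, v} \<notin> E \<and> theta_drawing k V (insert {u, v} E) p)"

end

theory Submission imports Defs
begin

text \<open>Index the vertices along the hull, so that crossing of edges becomes interleaving of index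
  pairs. Among all proper colourings take one with the least sum of colours: then every edge of
  colour \<open>c\<close> crosses an edge of each smaller colour. Together with saturation this shows that
  colour 1 contains the hull and triangulates it, that colour 2 also triangulates it (two crossing
  diagonals of a larger face would both have colour 1), and that the faces of colour 3 have at most
  four vertices (the diagonals of a pentagon form an odd cycle of crossings, so they cannot be
  coloured with 1 and 2 only). Counting edges from face sizes gives
  \<open>n + (n - 3) + (n - 3) + (n - 4) / 2\<close>.\<close>

section \<open>Interleaving pairs\<close>

definition interleave :: "'a::linorder \<times> 'a \<Rightarrow> 'a \<times> 'a \<Rightarrow> bool" where
  "interleave e f \<longleftrightarrow>
     fst e < fst f \<and> fst f < snd e \<and> snd e < snd f \<or>
     fst f < fst e \<and> fst e < snd f \<and> snd f < snd e"

lemma interleave_commute: "interleave e f \<longleftrightarrow> interleave f e"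
  by (auto simp: interleave_def)

lemma not_interleave_separated:
  assumes "a \<le> x" "y \<le> b" "c \<le> a \<or> b \<le> c" "d \<le> a \<or> b \<le> d"
  shows "\<not> interleave (x, y) (c, d)"
  using assms by (auto simp: interleave_def)

text \<open>A pair with one end strictly between \<open>a\<close> and \<open>b\<close> and the other
  strictly outside would interleave with \<open>(a, b)\<close>. This decides on which side of a cut
  each remaining edge falls.\<close>

lemma not_interleave_cases:
  assumes "\<not> interleave (c, d) (a, b)" "c < d"
  shows "a \<le> c \<and> d \<le> b \<or> (c \<le> a \<or> b \<le> c) \<and> (d \<le> a \<or> b \<le> d)"
proof (rule ccontr)
  assume "\<not> ?thesis"
  then show False
    using assms unfolding interleave_def fst_conv snd_conv not_less de_Morgan_disj de_Morgan_conj
    by (metis leD le_less_trans less_imp_le not_le_imp_less)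
qed

definition chords :: "'a::linorder set \<Rightarrow> ('a \<times> 'a) set" where
  "chords W = {(a, b). a \<in> W \<and> b \<in> W \<and> a < b}"

lemma finite_chords: "finite W \<Longrightarrow> finite (chords W)"
  by (rule finite_subset[of _ "W \<times> W"]) (auto simp: chords_def)

text \<open>The hypothesis on \<open>X\<close> says that all faces of the dissection \<open>S\<close> have at most \<open>k + 2\<close>
  vertices. The induction cuts the polygon along a chord of \<open>S\<close>; hull edges are allowed in \<open>S\<close>.\<close>

lemma card_le_dissection:
  fixes W :: "'a::linorder set"
  assumes "finite W" "S \<subseteq> chords W"
    and "\<And>e f. e \<in> S \<Longrightarrow> f \<in> S \<Longrightarrow> \<not> interleave e f"
    and "\<And>X. X \<subseteq> W \<Longrightarrow> card X = k + 3 \<Longrightarrow> \<exists>d\<in>chords X. \<exists>e\<in>S. interleave d e"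
  shows "card W \<le> k * (card S + 1) + 2"
  using assms
proof (induction "card S" arbitrary: S W rule: less_induct)
  case less
  have fS: "finite S" using finite_chords less.prems finite_subset by blast
  show ?case
  proof (cases "S = {}")
    case True
    have "card W < k + 3"
    proof (rule ccontr)
      assume "\<not> card W < k + 3"
      then obtain X where "X \<subseteq> W" "card X = k + 3"
        by (meson not_less obtain_subset_with_card_n)
      then show False using less.prems(4) True by blast
    qed
    then show ?thesis using True by simp
  next
    case False
    then obtain a b where ab: "(a, b) \<in> S" by auto
    then have abW: "a \<in> W" "b \<in> W" "a < b" using less.prems(2) by (auto simp: chords_def)
    define U where "U = {x \<in> W. a \<le> x \<and> x \<le> b}"
    define O' where "O' = {x \<in> W. x \<le> a \<or> b \<le> x}"
    define SU where "SU = (S - {(a, b)}) \<inter> chords U"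
    define SO where "SO = (S - {(a, b)}) \<inter> chords O'"
    have fin: "finite U" "finite O'" using less.prems(1) by (auto simp: U_def O'_def)
    have "W = U \<union> O'" "U \<inter> O' = {a, b}" using abW by (auto simp: U_def O'_def)
    \<comment> \<open>Both ends of the cutting chord belong to both sides and are counted
      twice.\<close>
    then have cW: "card W + 2 = card U + card O'"
      using card_Un_Int[OF fin] abW by simp
    have split: "e \<in> SU \<or> e \<in> SO" if "e \<in> S" "e \<noteq> (a, b)" for e
    proof -
      have "e \<in> chords W" using that(1) less.prems(2) by blast
      then obtain c d where cd: "e = (c, d)" "c \<in> W" "d \<in> W" "c < d"
        unfolding chords_def by blast
      then have "a \<le> c \<and> d \<le> b \<or> (c \<le> a \<or> b \<le> c) \<and> (d \<le> a \<or> b \<le> d)"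
        using less.prems(3)[OF that(1) ab] by (intro not_interleave_cases) auto
      then have "e \<in> chords U \<or> e \<in> chords O'"
        using cd by (auto simp: chords_def U_def O'_def)
      then show ?thesis using that by (auto simp: SU_def SO_def)
    qed
    have apart: "\<not> interleave e f" if "e \<in> chords U" "f \<in> chords O'" for e f
      using that not_interleave_separated[of a "fst e" "snd e" b "fst f" "snd f"]
      by (auto simp: chords_def U_def O'_def)
    have abUO: "(a, b) \<in> chords U" "(a, b) \<in> chords O'"
      using abW by (auto simp: chords_def U_def O'_def)
    have mono: "chords X \<subseteq> chords Y" if "X \<subseteq> Y" for X Y :: "'a set"
      using that by (auto simp: chords_def)
    have SUO: "SU \<inter> SO = {}"
      by (auto simp: SU_def SO_def chords_def U_def O'_def)
    have "S = insert (a, b) (SU \<union> SO)" using split ab by (auto simp: SU_def SO_def)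
    moreover have "finite SU" "finite SO" using fS by (auto simp: SU_def SO_def)
    moreover have "(a, b) \<notin> SU \<union> SO" by (auto simp: SU_def SO_def)
    ultimately have cS: "card S = card SU + card SO + 1"
      by (metis SUO Suc_eq_plus1 card_Un_disjoint card_insert_disjoint finite_UnI)
    have "card U \<le> k * (card SU + 1) + 2"
    proof (rule less.hyps)
      show "card SU < card S" using cS by simp
      show "\<exists>d\<in>chords X. \<exists>e\<in>SU. interleave d e" if "X \<subseteq> U" "card X = k + 3" for X
      proof -
        have "X \<subseteq> W" using that(1) by (auto simp: U_def)
        then obtain d e where de: "d \<in> chords X" "e \<in> S" "interleave d e"
          using less.prems(4) \<open>card X = k + 3\<close> by blast
        \<comment> \<open>The chord \<open>d\<close> lies within \<open>U\<close>, so nothing on the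
          other side crosses it; \<open>(a, b)\<close> is excluded as well because it is also a
          chord of \<open>O'\<close>. The crossing edge must therefore come from
          \<open>SU\<close>.\<close>
        have "e \<noteq> (a, b)" "e \<notin> SO"
          using apart[of d e] de mono[OF that(1)] abUO by (auto simp: SO_def)
        then show ?thesis using split de by blast
      qed
    qed (use fin less.prems(3) in \<open>auto simp: SU_def\<close>)
    moreover have "card O' \<le> k * (card SO + 1) + 2"
    proof (rule less.hyps)
      show "card SO < card S" using cS by simp
      show "\<exists>d\<in>chords X. \<exists>e\<in>SO. interleave d e" if "X \<subseteq> O'" "card X = k + 3" for X
      proof -
        have "X \<subseteq> W" using that(1) by (auto simp: O'_def)
        then obtain d e where de: "d \<in> chords X" "e \<in> S" "interleave d e"
          using less.prems(4) \<open>card X = k + 3\<close> by blast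
        have "e \<noteq> (a, b)" "e \<notin> SU"
          using apart[of e d] interleave_commute[of d e] de mono[OF that(1)] abUO
          by (auto simp: SU_def)
        then show ?thesis using split de by blast
      qed
    qed (use fin less.prems(3) in \<open>auto simp: SO_def\<close>)
    \<comment> \<open>Since \<open>(a, b)\<close> is counted in \<open>card S\<close>, the factors
      \<open>card SU + 1\<close> and \<open>card SO + 1\<close> add up to \<open>card S + 1\<close>;
      of the two summands 2, one cancels against the ends counted twice.\<close>
    ultimately show ?thesis using cW cS by (simp add: algebra_simps)
  qed
qed

section \<open>Increasing listings of four- and five-element sets\<close>

lemma card_Suc_minE:
  fixes X :: "'a::linorder set"
  assumes "card X = Suc m"
  obtains a Y where "X = insert a Y" "card Y = m" "\<And>y. y \<in> Y \<Longrightarrow> a < y"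
proof
  have X: "finite X" "X \<noteq> {}" using assms card.infinite by fastforce+
  show "X = insert (Min X) (X - {Min X})" using X by (simp add: insert_absorb)
  show "card (X - {Min X}) = m" using X assms by simp
  show "Min X < y" if "y \<in> X - {Min X}" for y
    using that X by (simp add: order_less_le) blast
qed

lemma card_4_sortedE:
  fixes X :: "'a::linorder set"
  assumes "card X = 4"
  obtains a b c d where "X = {a, b, c, d}" "a < b" "b < c" "c < d"
proof -
  obtain a A where a: "X = insert a A" "card A = Suc (Suc (Suc 0))" "\<And>y. y \<in> A \<Longrightarrow> a < y"
    using card_Suc_minE[of X "Suc (Suc (Suc 0))"] assms by (auto simp: eval_nat_numeral)
  obtain b B where b: "A = insert b B" "card B = Suc (Suc 0)" "\<And>y. y \<in> B \<Longrightarrow> b < y"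
    using card_Suc_minE[OF a(2)] by metis
  obtain c C where c: "B = insert c C" "card C = Suc 0" "\<And>y. y \<in> C \<Longrightarrow> c < y"
    using card_Suc_minE[OF b(2)] by metis
  obtain d where "C = {d}" using c(2) by (auto simp: card_1_singleton_iff)
  then show thesis using that[of a b c d] a b c by auto
qed

lemma card_5_sortedE:
  fixes X :: "'a::linorder set"
  assumes "card X = 5"
  obtains a b c d e where "X = {a, b, c, d, e}" "a < b" "b < c" "c < d" "d < e"
proof -
  obtain a A where a: "X = insert a A" "card A = 4" "\<And>y. y \<in> A \<Longrightarrow> a < y"
    using card_Suc_minE[of X 4] assms by auto
  obtain b c d e where "A = {b, c, d, e}" "b < c" "c < d" "d < e"
    using card_4_sortedE[OF a(2)] by metis
  then show thesis using that[of a b c d e] a by auto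
qed

section \<open>Saturated sets of index pairs\<close>

definition proper :: "(nat \<times> nat) set \<Rightarrow> (nat \<times> nat \<Rightarrow> nat) \<Rightarrow> bool" where
  "proper F \<phi> \<longleftrightarrow> \<phi> ` F \<subseteq> {1..3} \<and> (\<forall>e\<in>F. \<forall>f\<in>F. \<phi> e = \<phi> f \<longrightarrow> \<not> interleave e f)"

text \<open>Serves two purposes: for \<open>e\<close> outside \<open>F\<close> it extends the
  colouring to a new pair, and for \<open>e\<close> in \<open>F\<close> it recolours that pair, as
  \<open>insert e F\<close> is then \<open>F\<close> itself.\<close>

lemma proper_update:
  assumes "proper F \<phi>" "c \<in> {1..3}" "\<And>f. f \<in> F \<Longrightarrow> \<phi> f = c \<Longrightarrow> \<not> interleave e f"
  shows "proper (insert e F) (\<phi>(e := c))"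
  using assms interleave_commute unfolding proper_def
  by (auto simp: interleave_def)

text \<open>The combinatorial core, free of geometry. The bound is doubled and rearranged so that it
  stays within the natural numbers.\<close>

lemma saturated_pairs_card:
  assumes "n \<ge> 3" "F \<subseteq> chords {..<n}" "proper F \<phi>"
    and sat: "\<And>e \<psi>. e \<in> chords {..<n} \<Longrightarrow> e \<notin> F \<Longrightarrow> \<not> proper (insert e F) \<psi>"
  shows "7 * n \<le> 2 * card F + 16"
proof -
  have fF: "finite F" using assms(2) finite_chords finite_subset by blast
  obtain \<psi> where \<psi>: "proper F \<psi>" and min: "\<And>\<theta>. proper F \<theta> \<Longrightarrow> sum \<psi> F \<le> sum \<theta> F"
    using ex_has_least_nat[of "proper F" \<phi> "\<lambda>\<theta>. sum \<theta> F"] assms(3) by blast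
  \<comment> \<open>A pair that crosses nothing of colour \<open>c\<close> could receive colour
    \<open>c\<close>. Saturation then puts it in \<open>F\<close>, and minimality of the colour sum
    forbids its present colour from exceeding \<open>c\<close>.\<close>
  have uncrossed: "e \<in> F \<and> \<psi> e \<le> c"
    if e: "e \<in> chords {..<n}" and c: "c \<in> {1..3}"
      and un: "\<And>f. f \<in> F \<Longrightarrow> \<psi> f = c \<Longrightarrow> \<not> interleave e f" for e c
  proof -
    have pr: "proper (insert e F) (\<psi>(e := c))" using proper_update[OF \<psi> c un] by simp
    then have eF: "e \<in> F" using sat e by blast
    then have "sum \<psi> F \<le> sum (\<psi>(e := c)) F" using min pr by (metis insert_absorb)
    also have "\<dots> = c + sum \<psi> (F - {e})"
      using eF fF by (simp add: sum.remove)
    finally show ?thesis using eF fF by (simp add: sum.remove)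
  qed
  define D where "D c = {e \<in> F. \<psi> e = c}" for c
  have D_nc: "\<not> interleave e f" if "e \<in> D c" "f \<in> D c" for e f c
    using \<psi> that by (auto simp: D_def proper_def)
  have D_range: "\<psi> e \<in> {1..3}" if "e \<in> F" for e
    using \<psi> that by (auto simp: proper_def)
  have D_sub: "D c \<subseteq> chords {..<n}" for c using assms(2) by (auto simp: D_def)
  have fD: "finite (D c)" for c using fF by (simp add: D_def)
  have un: "e \<in> F \<and> \<psi> e \<le> c"
    if "e \<in> chords {..<n}" "c \<in> {1..3}" "\<not> (\<exists>f\<in>D c. interleave e f)" for e c
    using uncrossed[OF that(1,2)] that(3) by (auto simp: D_def)

  define H where "H = insert (0, n - 1) ((\<lambda>i. (i, Suc i)) ` {..<n - 1})"
  \<comment> \<open>The closing edge of the hull is a new one because n is at least 3; for n = 2 it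
    would coincide with \<open>(0, 1)\<close>.\<close>
  have "(0, n - 1) \<notin> (\<lambda>i. (i, Suc i)) ` {..<n - 1}" using assms(1) by auto
  then have cH: "card H = n" "finite H"
    using assms(1) by (simp_all add: H_def card_image inj_on_def)
  have H_chords: "H \<subseteq> chords {..<n}"
    using assms(1) by (auto simp: H_def chords_def)
  have H_un: "\<not> interleave h f" "\<not> interleave f h" if "h \<in> H" "f \<in> chords {..<n}" for h f
    using that by (auto simp: H_def chords_def interleave_def)
  have HD1: "H \<subseteq> D 1"
  proof
    fix h assume h: "h \<in> H"
    have "\<not> (\<exists>f\<in>D 1. interleave h f)" using H_un(1)[OF h] D_sub by blast
    then have "h \<in> F \<and> \<psi> h \<le> 1" using un[of h 1] h H_chords by auto
    then show "h \<in> D 1" using D_range[of h] by (auto simp: D_def)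
  qed

  \<comment> \<open>With \<open>k = 1\<close> the faces are triangles. Hull edges cross nothing, so
    removing them leaves the faces unchanged and the bound counts proper diagonals only.\<close>
  have "card {..<n} \<le> 1 * (card (D 1 - H) + 1) + 2"
  proof (rule card_le_dissection)
    fix X :: "nat set" assume X: "X \<subseteq> {..<n}" "card X = 1 + 3"
    have "card X = 4" using X(2) by simp
    then obtain a b c d where abcd: "X = {a, b, c, d}" "a < b" "b < c" "c < d"
      by (rule card_4_sortedE)
    then have ch: "(a, c) \<in> chords X" "(b, d) \<in> chords X" and x: "interleave (a, c) (b, d)"
      by (auto simp: chords_def interleave_def)
    have chn: "chords X \<subseteq> chords {..<n}" using X(1) by (auto simp: chords_def)
    show "\<exists>d\<in>chords X. \<exists>e\<in>D 1 - H. interleave d e"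
    proof (rule ccontr)
      assume no: "\<not> ?thesis"
      \<comment> \<open>If no edge of colour 1 crosses a chord of the quadrilateral, all its chords
        have colour 1, including the two crossing diagonals.\<close>
      have "e \<in> D 1" if "e \<in> chords X" for e
      proof -
        have "\<not> (\<exists>f\<in>D 1. interleave e f)" using no that H_un chn by blast
        then show ?thesis using un[of e 1] D_range[of e] that chn by (auto simp: D_def)
      qed
      then show False using D_nc ch x by blast
    qed
  qed (use D_sub D_nc in auto)
  then have c1: "n \<le> card (D 1 - H) + 3" by simp

  have "card {..<n} \<le> 1 * (card (D 2) + 1) + 2"
  proof (rule card_le_dissection)
    fix X :: "nat set" assume X: "X \<subseteq> {..<n}" "card X = 1 + 3"
    have "card X = 4" using X(2) by simp
    then obtain a b c d where abcd: "X = {a, b, c, d}" "a < b" "b < c" "c < d"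
      by (rule card_4_sortedE)
    then have ch: "(a, c) \<in> chords X" "(b, d) \<in> chords X" and x: "interleave (a, c) (b, d)"
      by (auto simp: chords_def interleave_def)
    have chn: "chords X \<subseteq> chords {..<n}" using X(1) by (auto simp: chords_def)
    show "\<exists>d\<in>chords X. \<exists>e\<in>D 2. interleave d e"
    proof (rule ccontr)
      assume no: "\<not> ?thesis"
      have low: "e \<in> D 1 \<or> e \<in> D 2" if "e \<in> chords X" for e
      proof -
        have "e \<in> F \<and> \<psi> e \<le> 2" using no that un[of e 2] chn by auto
        then show ?thesis using D_range[of e] by (auto simp: D_def)
      qed
      \<comment> \<open>Each of the two diagonals crosses the other, and no chord of
        \<open>X\<close> crosses an edge of colour 2; so neither diagonal has colour 2.\<close>
      have "(a, c) \<in> D 1" "(b, d) \<in> D 1"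
        using low ch x no interleave_commute by blast+
      then show False using D_nc x by blast
    qed
  qed (use D_sub D_nc in auto)
  then have c2: "n \<le> card (D 2) + 3" by simp

  have "card {..<n} \<le> 2 * (card (D 3) + 1) + 2"
  proof (rule card_le_dissection)
    fix X :: "nat set" assume X: "X \<subseteq> {..<n}" "card X = 2 + 3"
    have "card X = 5" using X(2) by simp
    then obtain a b c d e where abcde: "X = {a, b, c, d, e}" "a < b" "b < c" "c < d" "d < e"
      by (rule card_5_sortedE)
    have chn: "chords X \<subseteq> chords {..<n}" using X by (auto simp: chords_def)
    have ch: "(a, c) \<in> chords X" "(b, d) \<in> chords X" "(c, e) \<in> chords X"
        "(a, d) \<in> chords X" "(b, e) \<in> chords X"
      using abcde by (auto simp: chords_def)
    \<comment> \<open>The diagonals of the pentagon, listed so that each crosses the next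
      cyclically: a 5-cycle, which has no proper colouring with two colours.\<close>
    have x: "interleave (a, c) (b, d)" "interleave (b, d) (c, e)" "interleave (c, e) (a, d)"
        "interleave (a, d) (b, e)" "interleave (b, e) (a, c)"
      using abcde by (auto simp: interleave_def)
    show "\<exists>d\<in>chords X. \<exists>e\<in>D 3. interleave d e"
    proof (rule ccontr)
      assume no: "\<not> ?thesis"
      \<comment> \<open>Colour 3 is ruled out by the neighbour \<open>g\<close> on the 5-cycle, a
        chord of \<open>X\<close> that would cross an edge of \<open>D 3\<close>.\<close>
      have low: "f \<in> D 1 \<or> f \<in> D 2" if f: "f \<in> chords X" "g \<in> chords X" "interleave g f" for f g
      proof -
        have "f \<in> F" using no f(1) un[of f 3] chn by auto
        moreover have "f \<notin> D 3" using no f by blast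
        moreover have "\<psi> f = 1 \<or> \<psi> f = 2 \<or> \<psi> f = 3" using D_range[OF \<open>f \<in> F\<close>] by auto
        ultimately show ?thesis by (auto simp: D_def)
      qed
      note l = low[OF ch(2) ch(1) x(1)] low[OF ch(3) ch(2) x(2)] low[OF ch(4) ch(3) x(3)]
        low[OF ch(5) ch(4) x(4)] low[OF ch(1) ch(5) x(5)]
      show False using l D_nc x by blast
    qed
  qed (use D_sub D_nc in auto)
  then have c3: "n \<le> 2 * card (D 3) + 4" by simp

  have "F = D 1 \<union> D 2 \<union> D 3"
  proof -
    have "\<psi> e = 1 \<or> \<psi> e = 2 \<or> \<psi> e = 3" if "e \<in> F" for e using D_range[OF that] by auto
    then show ?thesis by (auto simp: D_def)
  qed
  moreover have "D 1 \<inter> D 2 = {}" "(D 1 \<union> D 2) \<inter> D 3 = {}" by (auto simp: D_def)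
  ultimately have "card F = card (D 1) + card (D 2) + card (D 3)"
    using fD by (simp add: card_Un_disjoint)
  moreover have "card (D 1) = card (D 1 - H) + n"
    using HD1 cH fD by (metis card_Diff_subset card_mono le_add_diff_inverse2)
  ultimately show ?thesis using c1 c2 c3 by linarith
qed

section \<open>Points in convex position\<close>

text \<open>Twice the signed area of the triangle \<open>a b c\<close>, positive exactly when its
  corners run counterclockwise.\<close>

definition orient :: "real^2 \<Rightarrow> real^2 \<Rightarrow> real^2 \<Rightarrow> real" where
  "orient a b c = (b$1 - a$1) * (c$2 - a$2) - (b$2 - a$2) * (c$1 - a$1)"

lemma orient_rotate: "orient b c a = orient a b c"
  by (simp add: orient_def algebra_simps)

lemma orient_degenerate [simp]: "orient a b a = 0" "orient a b b = 0"
  by (simp_all add: orient_def)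

lemma orient_affine:
  "orient a b ((1 - u) *\<^sub>R c + u *\<^sub>R d) = (1 - u) * orient a b c + u * orient a b d"
  by (simp add: orient_def algebra_simps)

lemma orient_0_imp_collinear:
  assumes "orient a b c = 0"
  shows "collinear {a, b, c}"
proof (cases "a = c")
  case True
  then show ?thesis by (simp add: insert_commute)
next
  case False
  have o: "(b$1 - a$1) * (c$2 - a$2) = (b$2 - a$2) * (c$1 - a$1)"
    using assms by (simp add: orient_def)
  \<comment> \<open>The parameter \<open>u\<close> is solved from a coordinate in which
    \<open>a\<close> and \<open>c\<close> differ, hence the case split.\<close>
  have "\<exists>u. b$1 = u * a$1 + (1 - u) * c$1 \<and> b$2 = u * a$2 + (1 - u) * c$2"
  proof (cases "a$1 = c$1")
    case True
    then have ne: "c$2 - a$2 \<noteq> 0" using False by (auto simp: vec_eq_iff forall_2)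
    define u where "u = (c$2 - b$2) / (c$2 - a$2)"
    have u: "u * (c$2 - a$2) = c$2 - b$2" using ne by (simp add: u_def)
    have "b$1 = c$1" using o True ne by simp
    then show ?thesis using u True by (intro exI[of _ u]) (simp add: algebra_simps)
  next
    case neq: False
    define u where "u = (c$1 - b$1) / (c$1 - a$1)"
    have u: "u * (c$1 - a$1) = c$1 - b$1" using neq by (simp add: u_def)
    have "(c$1 - a$1) * b$2 = (c$1 - a$1) * (u * a$2 + (1 - u) * c$2)" using o u by algebra
    then have "b$2 = u * a$2 + (1 - u) * c$2" using neq by simp
    then show ?thesis using u by (intro exI[of _ u]) (simp add: algebra_simps)
  qed
  then have "\<exists>u. b = u *\<^sub>R a + (1 - u) *\<^sub>R c" by (simp add: vec_eq_iff forall_2)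
  then show ?thesis by (simp add: collinear_3_expand)
qed

text \<open>The points \<open>a\<close>, \<open>c\<close>, \<open>b\<close>, \<open>d\<close> run
  counterclockwise around a convex quadrilateral, with \<open>a b\<close> and \<open>c d\<close> as
  diagonals. In the affine dependence of four points each point is weighted by the area of the
  triangle of the other three; dividing by the common sum \<open>s\<close> of the weights yields the
  intersection point.\<close>

lemma open_segments_meet:
  assumes "orient a c b > 0" "orient a b d > 0" "orient a c d > 0" "orient c b d > 0"
  shows "open_segment a b \<inter> open_segment c d \<noteq> {}"
proof -
  have ne: "a \<noteq> b" "c \<noteq> d" using assms by (auto simp: orient_def)
  define s where "s = orient a c b + orient a b d"
  have s: "s = orient a c d + orient c b d" "s > 0"
    using assms by (auto simp: s_def orient_def algebra_simps)
  have eq: "orient c b d *\<^sub>R a + orient a c d *\<^sub>R b = orient a b d *\<^sub>R c + orient a c b *\<^sub>R d"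
    by (simp add: vec_eq_iff forall_2 orient_def algebra_simps)
  define x where "x = (1 / s) *\<^sub>R (orient c b d *\<^sub>R a + orient a c d *\<^sub>R b)"
  have "x = (1 - orient a c d / s) *\<^sub>R a + (orient a c d / s) *\<^sub>R b"
  proof -
    have "1 - orient a c d / s = orient c b d / s" using s by (simp add: field_simps)
    then show ?thesis by (simp add: x_def scaleR_add_right)
  qed
  moreover have "x = (1 - orient a c b / s) *\<^sub>R c + (orient a c b / s) *\<^sub>R d"
  proof -
    have "1 - orient a c b / s = orient a b d / s" using s(2) by (simp add: s_def field_simps)
    then show ?thesis by (simp add: x_def eq scaleR_add_right)
  qed
  moreover have "0 < orient a c d / s" "orient a c d / s < 1"
    "0 < orient a c b / s" "orient a c b / s < 1"
    using assms s by (auto simp: s_def)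
  ultimately have "x \<in> open_segment a b" "x \<in> open_segment c d"
    using ne unfolding in_segment by blast+
  then show ?thesis by blast
qed

text \<open>On the line through \<open>a\<close> and \<open>b\<close> the orientation vanishes, but
  strictly between \<open>c\<close> and \<open>d\<close> it is a convex combination, with positive
  weights, of two values of the same weak sign that are not both zero.\<close>

lemma open_segments_disjoint:
  assumes "orient a b c \<ge> 0 \<and> orient a b d \<ge> 0 \<or> orient a b c \<le> 0 \<and> orient a b d \<le> 0"
    and "orient a b c \<noteq> 0 \<or> orient a b d \<noteq> 0"
  shows "open_segment a b \<inter> open_segment c d = {}"
proof -
  have False if x: "x \<in> open_segment a b" "x \<in> open_segment c d" for x
  proof -
    have "orient a b x = 0"
      using x(1) by (auto simp: in_segment orient_affine)
    moreover obtain u where u: "0 < u" "u < 1" "x = (1 - u) *\<^sub>R c + u *\<^sub>R d"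
      using x(2) by (auto simp: in_segment)
    ultimately have "(1 - u) * orient a b c + u * orient a b d = 0"
      by (simp add: orient_affine)
    moreover have "1 - u > 0" using u by simp
    ultimately show False using assms u(1)
      by (smt (verit) mult_nonneg_nonneg mult_pos_pos mult_pos_neg mult_neg_pos
          mult_nonneg_nonpos)
  qed
  then show ?thesis by blast
qed

text \<open>A convex set stays convex when an extreme point is removed, so what remains still
  contains the hull of \<open>T\<close>.\<close>

lemma extreme_point_not_in_hull_rest:
  assumes "x extreme_point_of (convex hull S)" "T \<subseteq> S" "x \<notin> T"
  shows "x \<notin> convex hull T"
proof -
  have "convex (convex hull S - {x})" using assms(1) by (simp add: extreme_point_of_stillconvex)
  moreover have "T \<subseteq> convex hull S - {x}" using assms by (auto intro: hull_inc)
  ultimately show ?thesis using hull_minimal[of T "convex hull S - {x}" convex] by blast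
qed

text \<open>The three orientations, divided by their sum, are the barycentric coordinates of
  \<open>o'\<close> in the triangle.\<close>

lemma orient_cycle_in_triangle:
  assumes "orient o' x y > 0" "orient o' y z > 0" "orient o' z x > 0"
  shows "o' \<in> convex hull {x, y, z}"
proof -
  define s where "s = orient o' y z + orient o' z x + orient o' x y"
  have s: "s > 0" using assms by (simp add: s_def)
  have "s *\<^sub>R o' = orient o' y z *\<^sub>R x + orient o' z x *\<^sub>R y + orient o' x y *\<^sub>R z"
    by (simp add: s_def vec_eq_iff forall_2 orient_def algebra_simps)
  then have "(1 / s) *\<^sub>R (s *\<^sub>R o') =
      (1 / s) *\<^sub>R (orient o' y z *\<^sub>R x + orient o' z x *\<^sub>R y + orient o' x y *\<^sub>R z)" by simp
  then have "o' = (orient o' y z / s) *\<^sub>R x + (orient o' z x / s) *\<^sub>R y + (orient o' x y / s) *\<^sub>R z"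
    using s by (simp add: scaleR_add_right)
  moreover have "orient o' y z / s + orient o' z x / s + orient o' x y / s = 1"
    using s by (simp add: s_def flip: add_divide_distrib)
  moreover have "orient o' y z / s \<ge> 0" "orient o' z x / s \<ge> 0" "orient o' x y / s \<ge> 0"
    using assms s by auto
  ultimately show ?thesis unfolding convex_hull_3 by blast
qed

text \<open>\<open>V\<close> is sorted by angle around one of its vertices, which becomes the least element.\<close>

lemma convex_position_enumeration:
  assumes "straight_line_drawing V E p" "convex_drawing V p" "card V = n" "n > 0"
  obtains w where "bij_betw w {..<n} V"
    and "\<And>i j k. i < j \<Longrightarrow> j < k \<Longrightarrow> k < n \<Longrightarrow> orient (p (w i)) (p (w j)) (p (w k)) > 0"
proof -
  have finV: "finite V" using assms card_gt_0_iff by metis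
  have inj: "inj_on p V" using assms(1) by (simp add: straight_line_drawing_def)
  obtain o' where o': "o' \<in> V" using assms by fastforce
  have nz: "orient (p u) (p v) (p x) \<noteq> 0"
    if "u \<in> V" "v \<in> V" "x \<in> V" "u \<noteq> v" "v \<noteq> x" "u \<noteq> x" for u v x
    using assms(1) that orient_0_imp_collinear unfolding straight_line_drawing_def by blast
  have ext: "p u \<notin> convex hull (p ` {x, y, z})"
    if "{u, x, y, z} \<subseteq> V" "u \<notin> {x, y, z}" for u x y z
  proof (rule extreme_point_not_in_hull_rest)
    show "p u extreme_point_of (convex hull (p ` V))"
      using assms(2) that by (simp add: convex_drawing_def)
    show "p ` {x, y, z} \<subseteq> p ` V" using that by blast
    show "p u \<notin> p ` {x, y, z}" using that inj by (auto simp: inj_on_eq_iff)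
  qed
  \<comment> \<open>The angular order around \<open>o'\<close>. Since \<open>o'\<close> is a corner
    of the hull, all other points lie within a half-plane as seen from it, which makes the order
    transitive.\<close>
  define lt where "lt u v \<longleftrightarrow> u \<noteq> v \<and> v \<noteq> o' \<and> (u = o' \<or> orient (p o') (p u) (p v) > 0)" for u v
  have total: "lt u v \<or> lt v u" if "u \<in> V" "v \<in> V" "u \<noteq> v" for u v
  proof (cases "u = o' \<or> v = o'")
    case False
    moreover have "orient (p o') (p v) (p u) = - orient (p o') (p u) (p v)"
      by (simp add: orient_def algebra_simps)
    ultimately show ?thesis using nz[OF o' that(1,2)] that(3) by (auto simp: lt_def)
  qed (use that in \<open>auto simp: lt_def\<close>)
  have asym: "\<not> lt v u" if "lt u v" for u v
    using that by (auto simp: lt_def orient_def algebra_simps)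
  \<comment> \<open>A cyclic triple would surround \<open>o'\<close>, which is an extreme point and
    cannot lie in a triangle of other vertices.\<close>
  have trans: "lt x z" if "lt x y" "lt y z" "x \<in> V" "y \<in> V" "z \<in> V" for x y z
  proof (rule ccontr)
    assume n: "\<not> lt x z"
    have "x \<noteq> z" using that asym by blast
    with n total that have zx: "lt z x" by blast
    with that have "orient (p o') (p x) (p y) > 0" "orient (p o') (p y) (p z) > 0"
      "orient (p o') (p z) (p x) > 0" "o' \<notin> {x, y, z}"
      by (auto simp: lt_def)
    then show False
      using orient_cycle_in_triangle[of "p o'" "p x" "p y" "p z"] ext[of o' x y z] o' that by auto
  qed
  have pos: "orient (p x) (p y) (p z) > 0"
    if "lt x y" "lt y z" "x \<in> V" "y \<in> V" "z \<in> V" for x y z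
  proof (cases "x = o'")
    case True
    then show ?thesis using that by (auto simp: lt_def)
  next
    case False
    have xz: "lt x z" using trans that by blast
    have o: "orient (p o') (p x) (p y) > 0" "orient (p o') (p y) (p z) > 0"
      "orient (p o') (p x) (p z) > 0" "o' \<notin> {x, y, z}" "x \<noteq> y" "y \<noteq> z" "x \<noteq> z"
      using that xz False by (auto simp: lt_def)
    show ?thesis
    proof (rule ccontr)
      assume "\<not> ?thesis"
      then have "orient (p x) (p y) (p z) < 0" using nz[of x y z] that o by force
      \<comment> \<open>Otherwise \<open>y\<close> would lie in the triangle \<open>o' x z\<close>.\<close>
      then have "orient (p y) (p o') (p x) > 0" "orient (p y) (p x) (p z) > 0"
        "orient (p y) (p z) (p o') > 0"
        using o by (auto simp: orient_def algebra_simps)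
      then have "p y \<in> convex hull {p o', p x, p z}"
        by (rule orient_cycle_in_triangle)
      then show False using ext[of y o' x z] o' o that by auto
    qed
  qed
  \<comment> \<open>The number of predecessors turns the strict total order into a bijection onto
    the indices below \<open>n\<close>.\<close>
  define r where "r v = card {u \<in> V. lt u v}" for v
  have r_less: "r u < r v" if "lt u v" "u \<in> V" "v \<in> V" for u v
    unfolding r_def
  proof (rule psubset_card_mono)
    show "{x \<in> V. lt x u} \<subset> {x \<in> V. lt x v}"
    proof (rule psubsetI)
      show "{x \<in> V. lt x u} \<subseteq> {x \<in> V. lt x v}" using trans that by blast
      show "{x \<in> V. lt x u} \<noteq> {x \<in> V. lt x v}" using asym that by blast
    qed
  qed (use finV in simp)
  have r_inj: "inj_on r V" using r_less total by (metis inj_onI less_irrefl)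
  have "r v < n" if "v \<in> V" for v
    unfolding r_def assms(3)[symmetric]
    by (rule psubset_card_mono) (use that finV in \<open>auto simp: lt_def\<close>)
  then have r_bij: "bij_betw r V {..<n}"
    using r_inj assms(3) by (metis bij_betw_def card_image card_lessThan card_subset_eq
        finite_lessThan image_subsetI lessThan_iff)
  define w where "w = inv_into V r"
  have w_bij: "bij_betw w {..<n} V" unfolding w_def by (rule bij_betw_inv_into[OF r_bij])
  have wV: "w i \<in> V" "r (w i) = i" if "i < n" for i
    using bij_betw_apply[OF w_bij, of i] bij_betw_inv_into_right[OF r_bij, of i] that
    by (simp_all add: w_def)
  have w_lt: "lt (w i) (w j)" if "i < j" "j < n" for i j
    using total[of "w i" "w j"] r_less[of "w j" "w i"] wV[of i] wV[of j] that by force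
  show thesis
  proof (rule that[OF w_bij])
    fix i j k :: nat assume "i < j" "j < k" "k < n"
    then show "orient (p (w i)) (p (w j)) (p (w k)) > 0"
      using pos w_lt wV by auto
  qed
qed

section \<open>Crossings and interleaving\<close>

text \<open>Interleaving edges are the diagonals of a convex quadrilateral. Otherwise both ends of
  one edge lie weakly on the same side of the line through the other.\<close>

lemma edges_cross_iff_interleave:
  assumes inj: "inj_on w {..<n}" "inj_on p (w ` {..<n})"
    and pos: "\<And>i j k. i < j \<Longrightarrow> j < k \<Longrightarrow> k < n \<Longrightarrow> orient (p (w i)) (p (w j)) (p (w k)) > 0"
    and ij: "i < j" "j < n" and kl: "k < l" "l < n"
  shows "edges_cross p {w i, w j} {w k, w l} \<longleftrightarrow> interleave (i, j) (k, l)"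
proof -
  let ?q = "\<lambda>i. p (w i)"
  have q_eq: "?q x = ?q y \<longleftrightarrow> x = y" and w_eq: "w x = w y \<longleftrightarrow> x = y" if "x < n" "y < n" for x y
    using inj that by (auto simp: inj_on_eq_iff)
  have ri: "rel_interior (edge_segment p {w x, w y}) = open_segment (?q x) (?q y)"
    if "x < y" "y < n" for x y
    using that q_eq[of x y]
    by (simp add: edge_segment_def rel_interior_closed_segment flip: segment_convex_hull)
  have same: "{w i, w j} = {w k, w l} \<longleftrightarrow> (i, j) = (k, l)"
    using ij kl w_eq by (auto simp: doubleton_eq_iff)
  have meet: "open_segment (?q a) (?q b) \<inter> open_segment (?q c) (?q d) \<noteq> {}"
    if "a < c" "c < b" "b < d" "d < n" for a b c d
    using that by (intro open_segments_meet pos) auto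
  show ?thesis
  proof
    assume "interleave (i, j) (k, l)"
    moreover from this have "(i, j) \<noteq> (k, l)" by (auto simp: interleave_def)
    moreover have "open_segment (?q i) (?q j) \<inter> open_segment (?q k) (?q l) \<noteq> {}"
      using \<open>interleave (i, j) (k, l)\<close> meet[of i k j l] meet[of k i l j] ij kl
      by (auto simp: interleave_def)
    ultimately show "edges_cross p {w i, w j} {w k, w l}"
      using same ri ij kl by (simp add: edges_cross_def)
  next
    assume cr: "edges_cross p {w i, w j} {w k, w l}"
    show "interleave (i, j) (k, l)"
    proof (rule ccontr)
      assume ni: "\<not> interleave (i, j) (k, l)"
      have ne: "(i, j) \<noteq> (k, l)" using cr same by (auto simp: edges_cross_def)
      have outer: "orient (?q i) (?q j) (?q m) > 0" if "m < i \<or> j < m" "m < n" for m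
        using pos[of m i j] pos[of i j m] orient_rotate that ij by metis
      have inner: "orient (?q i) (?q j) (?q m) < 0" if "i < m" "m < j" for m
      proof -
        have "orient (?q i) (?q j) (?q m) = - orient (?q i) (?q m) (?q j)"
          by (simp add: orient_def algebra_simps)
        then show ?thesis using pos[of i m j] that ij by simp
      qed
      \<comment> \<open>The weak inequalities include the ends \<open>i\<close> and
        \<open>j\<close>, where the orientation is zero, so edges with a common vertex need no
        separate treatment.\<close>
      have sgn: "orient (?q i) (?q j) (?q m) \<ge> 0 \<longleftrightarrow> m \<le> i \<or> j \<le> m"
        "orient (?q i) (?q j) (?q m) \<le> 0 \<longleftrightarrow> i \<le> m \<and> m \<le> j" if "m < n" for m
      proof -
        consider "m < i \<or> j < m" | "m = i \<or> m = j" | "i < m" "m < j"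
          by (meson linorder_less_linear)
        then have "(orient (?q i) (?q j) (?q m) \<ge> 0 \<longleftrightarrow> m \<le> i \<or> j \<le> m) \<and>
            (orient (?q i) (?q j) (?q m) \<le> 0 \<longleftrightarrow> i \<le> m \<and> m \<le> j)"
        proof cases
          case 1
          then show ?thesis using outer[OF 1 that] ij by auto
        next
          case 2
          then show ?thesis using ij by auto
        next
          case 3
          then show ?thesis using inner[OF 3] by auto
        qed
        then show "orient (?q i) (?q j) (?q m) \<ge> 0 \<longleftrightarrow> m \<le> i \<or> j \<le> m"
          "orient (?q i) (?q j) (?q m) \<le> 0 \<longleftrightarrow> i \<le> m \<and> m \<le> j" by blast+
      qed
      have kln: "k < n" "l < n" using kl by auto
      have "open_segment (?q i) (?q j) \<inter> open_segment (?q k) (?q l) = {}"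
      proof (rule open_segments_disjoint)
        show "orient (?q i) (?q j) (?q k) \<ge> 0 \<and> orient (?q i) (?q j) (?q l) \<ge> 0 \<or>
            orient (?q i) (?q j) (?q k) \<le> 0 \<and> orient (?q i) (?q j) (?q l) \<le> 0"
          unfolding sgn[OF kln(1)] sgn[OF kln(2)]
          using not_interleave_cases[of k l i j] ni kl(1)
            interleave_commute[of "(i, j)" "(k, l)"] by (auto dest: less_imp_le)
        \<comment> \<open>Distinct edges share at most one end, so the two orientations do not both
          vanish.\<close>
        have "k \<notin> {i, j} \<or> l \<notin> {i, j}" using ne ij kl by auto
        then show "orient (?q i) (?q j) (?q k) \<noteq> 0 \<or> orient (?q i) (?q j) (?q l) \<noteq> 0"
          using sgn[OF kln(1)] sgn[OF kln(2)] by force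
      qed
      then show False using cr ri ij kl by (simp add: edges_cross_def)
    qed
  qed
qed

section \<open>Transfer from drawings to index pairs\<close>

theorem theorem2p9:
  fixes V :: "'a set" and E :: "'a set set" and p :: "'a \<Rightarrow> real^2" and n :: nat
  assumes "n \<ge> 3"
    and "card V = n"
    and "saturated_theta_drawing 3 V E p"
    and "convex_drawing V p"
  shows "real (card E) \<ge> 7 / 2 * real n - 8"
proof -
  have th: "theta_drawing 3 V E p"
    and sat: "\<And>u v. u \<in> V \<Longrightarrow> v \<in> V \<Longrightarrow> u \<noteq> v \<Longrightarrow> {u, v} \<notin> E \<Longrightarrow>
      \<not> theta_drawing 3 V (insert {u, v} E) p"
    using assms(3) by (auto simp: saturated_theta_drawing_def)
  have sl: "straight_line_drawing V E p" using th by (simp add: theta_drawing_def)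
  obtain w where w: "bij_betw w {..<n} V"
    and pos: "\<And>i j k. i < j \<Longrightarrow> j < k \<Longrightarrow> k < n \<Longrightarrow> orient (p (w i)) (p (w j)) (p (w k)) > 0"
    using convex_position_enumeration[OF sl assms(4,2)] assms(1) by auto
  have winj: "inj_on w {..<n}" and wV: "w ` {..<n} = V" using w by (auto simp: bij_betw_def)
  have pinj: "inj_on p (w ` {..<n})" using sl wV by (simp add: straight_line_drawing_def)
  \<comment> \<open>Each edge is represented by its increasing index pair; \<open>c\<close> maps the
    pair back to the edge and is injective on \<open>K\<close>.\<close>
  define c where "c = (\<lambda>(i, j). {w i, w j})"
  define K where "K = chords {..<n}"
  have cinj: "inj_on c K"
  proof (rule inj_onI)
    fix e f assume ef: "e \<in> K" "f \<in> K" "c e = c f"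
    obtain i j k l where ij: "e = (i, j)" "i < j" "j < n" and kl: "f = (k, l)" "k < l" "l < n"
      using ef(1,2) by (auto simp: K_def chords_def)
    have "{i, j} \<subseteq> {..<n}" "{k, l} \<subseteq> {..<n}" "w ` {i, j} = w ` {k, l}"
      using ef(3) ij kl by (auto simp: c_def)
    then have "{i, j} = {k, l}" using inj_on_image_eq_iff[OF winj] by blast
    then show "e = f" using ij kl by (auto simp: doubleton_eq_iff)
  qed
  have cross: "edges_cross p (c e) (c f) \<longleftrightarrow> interleave e f" if "e \<in> K" "f \<in> K" for e f
    using that edges_cross_iff_interleave[OF winj pinj pos]
    by (auto simp: c_def K_def chords_def)
  have edge: "\<exists>e\<in>K. c e = {u, v}" if "u \<in> V" "v \<in> V" "u \<noteq> v" for u v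
  proof -
    have "u \<in> w ` {..<n}" "v \<in> w ` {..<n}" using that wV by auto
    then obtain i j where ij: "i < n" "j < n" "u = w i" "v = w j" by blast
    then have "i \<noteq> j" using \<open>u \<noteq> v\<close> by blast
    then consider "i < j" | "j < i" by (rule linorder_neqE_nat)
    then show ?thesis
    proof cases
      case 1
      then show ?thesis using ij by (intro bexI[of _ "(i, j)"]) (auto simp: c_def K_def chords_def)
    next
      case 2
      then show ?thesis using ij by (intro bexI[of _ "(j, i)"]) (auto simp: c_def K_def chords_def)
    qed
  qed
  define F where "F = {e \<in> K. c e \<in> E}"
  have EF: "E = c ` F"
  proof -
    have "\<exists>e\<in>F. g = c e" if "g \<in> E" for g
    proof -
      have "g \<subseteq> V" "card g = 2"
        using sl that by (auto simp: straight_line_drawing_def simple_graph_def)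
      then obtain u v where g: "g = {u, v}" "u \<in> V" "v \<in> V" "u \<noteq> v" by (auto simp: card_2_iff)
      then obtain e where "e \<in> K" "c e = g" using edge[OF g(2-4)] by metis
      then show ?thesis using that by (intro bexI[of _ e]) (simp_all add: F_def)
    qed
    moreover have "c ` F \<subseteq> E" by (simp add: F_def image_subset_iff)
    ultimately show ?thesis by blast
  qed
  have FK: "F \<subseteq> K" by (auto simp: F_def)
  obtain \<phi> :: "'a set \<Rightarrow> nat" where \<phi>: "\<phi> ` E \<subseteq> {1..3}"
    "\<And>e f. e \<in> E \<Longrightarrow> f \<in> E \<Longrightarrow> \<phi> e = \<phi> f \<Longrightarrow> \<not> edges_cross p e f"
    using th unfolding theta_drawing_def by blast
  have "proper F (\<phi> \<circ> c)"
    unfolding proper_def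
  proof (intro conjI ballI impI)
    show "(\<phi> \<circ> c) ` F \<subseteq> {1..3}" using \<phi>(1) EF by (simp add: image_comp)
    show "\<not> interleave e f" if "e \<in> F" "f \<in> F" "(\<phi> \<circ> c) e = (\<phi> \<circ> c) f" for e f
      using \<phi>(2)[of "c e" "c f"] cross[of e f] FK EF that by auto
  qed
  moreover have "\<not> proper (insert e F) \<psi>" if e: "e \<in> chords {..<n}" "e \<notin> F" for e \<psi>
  proof
    \<comment> \<open>Carried over to edges by the inverse of \<open>c\<close>, such a colouring
      would make the drawing with the additional edge a \<open>theta_drawing\<close>, against
      saturation.\<close>
    assume pr: "proper (insert e F) \<psi>"
    obtain i j where ij: "e = (i, j)" "i < j" "j < n" using e by (auto simp: chords_def)
    have uv: "w i \<in> V" "w j \<in> V" "w i \<noteq> w j" "c e = {w i, w j}"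
      using ij wV winj by (auto simp: c_def inj_on_eq_iff)
    have eK: "insert e F \<subseteq> K" using e FK by (simp add: K_def)
    have ins: "insert {w i, w j} E = c ` insert e F" using EF uv by simp
    have "straight_line_drawing V (insert {w i, w j} E) p"
      using sl uv by (auto simp: straight_line_drawing_def simple_graph_def)
    moreover have "(\<psi> \<circ> inv_into K c) ` (c ` insert e F) \<subseteq> {1..3}"
    proof -
      have "inv_into K c (c f) = f" if "f \<in> insert e F" for f
        using cinj by (rule inv_into_f_f) (use that eK in blast)
      then have "(\<psi> \<circ> inv_into K c) ` (c ` insert e F) = \<psi> ` insert e F"
        unfolding image_comp by (intro image_cong) simp_all
      then show ?thesis using pr by (simp only: proper_def)
    qed
    moreover have "\<not> edges_cross p (c f) (c g)"
      if "f \<in> insert e F" "g \<in> insert e F"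
        "(\<psi> \<circ> inv_into K c) (c f) = (\<psi> \<circ> inv_into K c) (c g)" for f g
    proof -
      have fg: "f \<in> K" "g \<in> K" using that eK by auto
      then have "\<psi> f = \<psi> g" using that(3) cinj by simp
      then show ?thesis using pr that(1,2) unfolding cross[OF fg] proper_def by blast
    qed
    ultimately have "theta_drawing 3 V (insert {w i, w j} E) p"
      unfolding theta_drawing_def ins by blast
    moreover have "{w i, w j} \<notin> E" using e uv(4) by (auto simp: F_def K_def)
    ultimately show False using sat uv by blast
  qed
  ultimately have "7 * n \<le> 2 * card F + 16"
    using saturated_pairs_card[of n F "\<phi> \<circ> c"] assms(1) FK by (simp add: K_def)
  moreover have "card E = card F"
    using EF card_image[OF inj_on_subset[OF cinj FK]] by simp
  ultimately show ?thesis by linarith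
qed

end
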